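(* Consider an execution of the APEX algorithm (defined in the context) with $T$ rounds on an outcome space $\mathcal X$, with $n$ players. Fix a player $i$ with token budget $B_i$ and true utility function $f_i:\mathcal X\to\mathbb R$. Suppose that $f_i(x)\in[0,1]$ for all $x\in\mathcal X$, and that during the execution, with budget $B_i$ and a truthfully reported $f_i$, player $i$ (who plays the bids $(\lambda_{i,t})_{t=0}^{T-1}$) has strong regret at most $\varepsilon$. Suppose further that the heuristic $\mathcal H$ is locally correct. Then reporting $f_i$ truthfully and playing $(\lambda_{i,t})_{t=0}^{T-1}$ is a $(2\varepsilon)$-dominant strategy for the menu of options available to player $i$ that is induced by the mechanism.
   Context: Heuristic. $\mathcal H$ is a local optimization rule which, given an objective $G:\mathcal X\to\mathbb R$ and a starting point $X\in\mathcal X$, returns a point $\mathcal H(G,X)\in\mathcal X$, obtained by maximizing $G$ starting at $X$. APEX algorithm. Players report $f_1,\dots,f_n:\mathcal X\to\mathbb R$; the principal has utility $f_0:\mathcal X\to\mathbb R$; a starting point $X_0\in\mathcal X$ is fixed. In each round $t=0,\dots,T-1$: bids $\lambda_{j,t}\ge 0$ are collected from the players $j=1,\dots,n$; a regularizer $R_t$ on $\mathcal X$ (which may depend on $t,X_0,\dots,X_t$) is selected; one sets $F_t:=f_0+\sum_{j=1}^n\lambda_{j,t}f_j+R_t$ and $X_{t+1}:=\mathcal H(F_t,X_t)$; for each player $i$, one sets $F_t^{-i}:=f_0+\sum_{j\ne i}\lambda_{j,t}f_j+R_t$ and $X_{t+1}^{-i}:=\mathcal H(F_t^{-i},X_t)$,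 and charges player $i$ the amount $C_{i,t}:=F_t^{-i}(X_{t+1}^{-i})-F_t^{-i}(X_{t+1})$ of tokens. Menu induced by the mechanism for player $i$. The points $X_t$, the functions $F_t^{-i}$ and the points $X_{t+1}^{-i}$ are kept from the execution. An option consists of a utility function $\tilde f_i:\mathcal X\to\mathbb R$ and bids $(\tilde\lambda_{i,t})_{t=0}^{T-1}$, $\tilde\lambda_{i,t}\ge 0$. In round $t$ it leads to the outcome $\tilde X_{t+1}:=\mathcal H(F_t^{-i}+\tilde\lambda_{i,t}\tilde f_i,\,X_t)$ and the charge $\tilde C_{i,t}(\tilde f_i,\tilde\lambda_{i,t}):=F_t^{-i}(X_{t+1}^{-i})-F_t^{-i}(\tilde X_{t+1})$. The option must be feasible: $\sum_{t=0}^{T-1}\tilde C_{i,t}(\tilde f_i,\tilde\lambda_{i,t})\le B_i$. The outcome of a feasible option is the uniform distribution on $\{\tilde X_1,\dots,\tilde X_T\}$; the option $(f_i,(\lambda_{i,t})_t)$ gives the uniform distribution on $\{X_1,\dots,X_T\}$. $(2\varepsilon)$-dominant. No feasible option of the menu improves the (true) utility of player $i$ by more than $2\varepsilon$ over that of the option $(f_i,(\lambda_{i,t})_t)$. Utility is measured on the same scale as strong regret below, i.e. as the total over the rounds: $\sum_{t=0}^{T-1} f_i(\tilde X_{t+1})\le\sum_{t=0}^{T-1} f_i(X_{t+1})+2\varepsilon$ for every feasible option. Local correctness. The points returned by $\mathcal H$ are local optimizers of the objectives given to it, in the sense that in round $t$, for player $i$, the point $\mathcal H(G,X_t)$ returned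 for an objective $G=F_t^{-i}+\lambda g$ ($\lambda\ge0$, $g:\mathcal X\to\mathbb R$ a possible report) satisfies $G(\mathcal H(G,X_t))\ge G(\mathcal H(G',X_t))$ for any other objective $G'=F_t^{-i}+\lambda' g'$ of this form. Strong regret. Consider a game of $T$ steps with budget $B$ and payoffs in $[0,M]$, where action $a_t$ at step $t$ gives utility $u_t(a_t)$ and costs $c_t(a_t)$. A sequence of actions $(a_t)$ with $\sum_t c_t(a_t)\le B$ has strong regret $\varepsilon$ if for all distributions on sequences $(a'_t)$ with $\mathbb E[\sum_t c_t(a'_t)]\le B$ one has $\mathbb E[\sum_t u_t(a'_t)]\le \sum_t u_t(a_t)+\varepsilon M$. Here it is applied to player $i$ with $B=B_i$, $M=1$, actions $\lambda\ge 0$ (the bid in round $t$, with $f_i$ reported truthfully and the rest of the execution held fixed), utility $f_i(\mathcal H(F_t^{-i}+\lambda f_i,X_t))$ and cost $\tilde C_{i,t}(f_i,\lambda)$. *)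

theory Defs
  imports "HOL-Probability.Probability"
begin

text \<open>
  The data of one run of the APEX mechanism. Players are numbered from \<open>1\<close> to \<open>num_players\<close>;
  \<open>bid E j t\<close> is the bid of player \<open>j\<close> in round \<open>t\<close>. As only a completed run is recorded,
  \<open>regularizer E t\<close> is the function that was actually selected in round \<open>t\<close>; it is otherwise
  arbitrary, so it may have been chosen depending on \<open>t\<close> and on the points visited so far.
\<close>

record 'x apex_run =
  num_rounds :: nat
  num_players :: nat
  heuristic :: "('x \<Rightarrow> real) \<Rightarrow> 'x \<Rightarrow> 'x"
  principal :: "'x \<Rightarrow> real"
  reported :: "nat \<Rightarrow> 'x \<Rightarrow> real"
  bid :: "nat \<Rightarrow> nat \<Rightarrow> real"
  regularizer :: "nat \<Rightarrow> 'x \<Rightarrow> real"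
  start :: 'x
  point :: "nat \<Rightarrow> 'x"

definition objective :: "'x apex_run \<Rightarrow> nat \<Rightarrow> 'x \<Rightarrow> real" where
  "objective E t x =
     principal E x + (\<Sum>j\<in>{1..num_players E}. bid E j t * reported E j x) + regularizer E t x"

definition objective_without :: "'x apex_run \<Rightarrow> nat \<Rightarrow> nat \<Rightarrow> 'x \<Rightarrow> real" where
  "objective_without E i t x =
     principal E x + (\<Sum>j\<in>{1..num_players E} - {i}. bid E j t * reported E j x) + regularizer E t x"

definition apex_execution :: "'x apex_run \<Rightarrow> bool" where
  "apex_execution E \<longleftrightarrow>
     (\<forall>t<num_rounds E. \<forall>j\<in>{1..num_players E}. 0 \<le> bid E j t) \<and>
     point E 0 = start E \<and>
     (\<forall>t<num_rounds E. point E (Suc t) = heuristic E (objective E t) (point E t))"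

definition point_without :: "'x apex_run \<Rightarrow> nat \<Rightarrow> nat \<Rightarrow> 'x" where
  "point_without E i t = heuristic E (objective_without E i t) (point E t)"

text \<open>
  With \<open>t\<close> ranging over the rounds \<open>0, \<dots>, T - 1\<close>, the value \<open>point_without E i t\<close> above and
  the value \<open>menu_outcome E i t g l\<close> below are the points with index \<open>t + 1\<close>.
\<close>

definition menu_objective ::
    "'x apex_run \<Rightarrow> nat \<Rightarrow> nat \<Rightarrow> ('x \<Rightarrow> real) \<Rightarrow> real \<Rightarrow> 'x \<Rightarrow> real" where
  "menu_objective E i t g l x = objective_without E i t x + l * g x"

definition menu_outcome ::
    "'x apex_run \<Rightarrow> nat \<Rightarrow> nat \<Rightarrow> ('x \<Rightarrow> real) \<Rightarrow> real \<Rightarrow> 'x" where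
  "menu_outcome E i t g l = heuristic E (menu_objective E i t g l) (point E t)"

definition menu_charge ::
    "'x apex_run \<Rightarrow> nat \<Rightarrow> nat \<Rightarrow> ('x \<Rightarrow> real) \<Rightarrow> real \<Rightarrow> real" where
  "menu_charge E i t g l =
     objective_without E i t (point_without E i t)
     - objective_without E i t (menu_outcome E i t g l)"

definition feasible_option ::
    "'x apex_run \<Rightarrow> nat \<Rightarrow> real \<Rightarrow> ('x \<Rightarrow> real) \<Rightarrow> (nat \<Rightarrow> real) \<Rightarrow> bool" where
  "feasible_option E i B g l \<longleftrightarrow>
     (\<forall>t<num_rounds E. 0 \<le> l t) \<and> (\<Sum>t<num_rounds E. menu_charge E i t g (l t)) \<le> B"

text \<open>
  \<open>truth_dominant E i B u \<delta>\<close>: in the menu of player \<open>i\<close> with budget \<open>B\<close> and true utility \<open>u\<close>, no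
  feasible option improves the total utility over that of the recorded run by more than \<open>\<delta>\<close>.
\<close>

definition truth_dominant ::
    "'x apex_run \<Rightarrow> nat \<Rightarrow> real \<Rightarrow> ('x \<Rightarrow> real) \<Rightarrow> real \<Rightarrow> bool" where
  "truth_dominant E i B u \<delta> \<longleftrightarrow>
     (\<forall>g l. feasible_option E i B g l \<longrightarrow>
        (\<Sum>t<num_rounds E. u (menu_outcome E i t g (l t)))
          \<le> (\<Sum>t<num_rounds E. u (point E (Suc t))) + \<delta>)"

definition locally_correct :: "'x apex_run \<Rightarrow> nat \<Rightarrow> bool" where
  "locally_correct E i \<longleftrightarrow>
     (\<forall>t<num_rounds E. \<forall>g g'. \<forall>l\<ge>0. \<forall>l'\<ge>0.
        menu_objective E i t g l (menu_outcome E i t g' l')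
          \<le> menu_objective E i t g l (menu_outcome E i t g l))"

text \<open>
  Strong regret (at most) \<open>\<epsilon>\<close> of the action sequence \<open>a\<close> in a game of \<open>T\<close> steps with action set
  \<open>A\<close>, utilities \<open>u\<close> with values in \<open>{0..M}\<close>, costs \<open>c\<close> and budget \<open>B\<close>. A distribution on
  action sequences is a probability measure on \<open>nat \<Rightarrow> 'a\<close>, of which only the coordinates below \<open>T\<close>
  matter; no \<open>\<sigma>\<close>-algebra is singled out. Integrability is required explicitly because the
  Bochner integral of a non-integrable function is \<open>0\<close>.
\<close>

definition has_strong_regret ::
    "nat \<Rightarrow> 'a set \<Rightarrow> (nat \<Rightarrow> 'a \<Rightarrow> real) \<Rightarrow> (nat \<Rightarrow> 'a \<Rightarrow> real) \<Rightarrow> real \<Rightarrow> real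
      \<Rightarrow> (nat \<Rightarrow> 'a) \<Rightarrow> real \<Rightarrow> bool" where
  "has_strong_regret T A u c B M a \<epsilon> \<longleftrightarrow>
     (\<forall>t<T. a t \<in> A) \<and>
     (\<Sum>t<T. c t (a t)) \<le> B \<and>
     (\<forall>D :: (nat \<Rightarrow> 'a) measure.
        prob_space D \<longrightarrow>
        (AE a' in D. \<forall>t<T. a' t \<in> A) \<longrightarrow>
        integrable D (\<lambda>a'. \<Sum>t<T. c t (a' t)) \<longrightarrow>
        integrable D (\<lambda>a'. \<Sum>t<T. u t (a' t)) \<longrightarrow>
        (\<integral>a'. (\<Sum>t<T. c t (a' t)) \<partial>D) \<le> B \<longrightarrow>
        (\<integral>a'. (\<Sum>t<T. u t (a' t)) \<partial>D) \<le> (\<Sum>t<T. u t (a t)) + \<epsilon> * M)"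

end

theory Submission
  imports Defs
begin

text \<open>
  In every round, local correctness makes the outcome for the bid \<open>l\<close> a maximizer of the Lagrangian
  \<open>l * utility - charge\<close> among all points the heuristic can return in that round. Hence a constant
  bid, or a mixture of two nearby constant bids which exhausts the budget exactly, does essentially
  as well as any feasible option, and strong regret compares the run with such mixtures. The argument
  needs some positive bid that the player can afford. If the budget is \<open>0\<close> this is not automatic: it
  holds because every real function attains its maximum on the set of reachable points, so that this
  set is finite, and the charge of a sufficiently small bid must then vanish.
\<close>

section \<open>Approximating an option by mixtures of two constant bids\<close>

lemma crossing_within:
  fixes a b d :: real
  assumes "a < b" "0 < d" "P a" "\<not> P b"
  obtains x y where "a \<le> x" "x < y" "y < x + d" "P x" "\<not> P y"
proof -
  obtain n :: nat where n: "(b - a) / d < real n"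
    using reals_Archimedean2 by blast
  have npos: "0 < real n"
    using n assms by (smt (verit) divide_pos_pos)
  \<comment> \<open>On a grid of mesh \<open>s < d\<close> from \<open>a\<close> to
    \<open>b\<close>, some single step leaves \<open>P\<close>; no continuity is involved.\<close>
  define s where "s = (b - a) / real n"
  have s: "0 < s" "s < d"
    using n npos assms by (auto simp: s_def field_simps)
  define g where "g k = a + real k * s" for k :: nat
  have "g n = b"
    using npos by (simp add: g_def s_def)
  then have "\<exists>k. \<not> P (g k)"
    using assms by metis
  moreover have "P (g 0)"
    using assms by (simp add: g_def)
  ultimately obtain k where k: "P (g k)" "\<not> P (g (Suc k))"
    using nat_induct[of "\<lambda>k. P (g k)"] by blast
  show thesis
    by (rule that[of "g k" "g (Suc k)"]) (use s k in \<open>auto simp: g_def algebra_simps\<close>)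
qed

text \<open>\<open>C\<close> and \<open>U\<close> are cost and utility of a constant bid,
  \<open>P\<close> and \<open>V\<close> those of a competing option. If all bids from
  \<open>l0\<close> on are affordable, one huge bid nearly maximizes utility. Otherwise two nearby
  bids straddle the budget, and mixing them spends it exactly.\<close>

lemma budget_mixture_near_optimal:
  fixes C U :: "real \<Rightarrow> real" and B K P V l0 e :: real
  assumes lagrangian: "\<And>l. 0 \<le> l \<Longrightarrow> C l - l * U l \<le> P - l * V"
    and nonneg: "\<And>l. 0 \<le> l \<Longrightarrow> 0 \<le> C l"
    and bounded: "\<And>l. U l - V \<le> K" "0 \<le> K"
    and budget: "P \<le> B"
    and affordable: "0 < l0" "C l0 \<le> B"
    and "0 < e"
  obtains x y q where "0 \<le> x" "0 \<le> y" "0 \<le> q" "q \<le> 1"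
    "(1 - q) * C x + q * C y \<le> B" "V \<le> (1 - q) * U x + q * U y + e"
proof (cases "\<forall>l\<ge>l0. C l \<le> B")
  case True
  \<comment> \<open>Chosen so that \<open>l * e\<close> absorbs the budget:
    \<open>l * (V - U l) \<le> P - C l \<le> B \<le> l * e\<close>.\<close>
  define l where "l = l0 + \<bar>B\<bar> / e"
  have "l0 \<le> l"
    using \<open>0 < e\<close> by (simp add: l_def)
  moreover have "l * e = l0 * e + \<bar>B\<bar>"
    using \<open>0 < e\<close> by (simp add: l_def distrib_right)
  moreover have "0 < l0 * e"
    using affordable \<open>0 < e\<close> by simp
  ultimately have l: "l0 \<le> l" "0 < l" "B \<le> l * e"
    using affordable by auto
  have "l * (V - U l) \<le> l * e"
    using lagrangian[of l] nonneg[of l] budget l by (simp add: algebra_simps)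
  then have "V - U l \<le> e"
    using l by simp
  then show thesis
    using True l by (intro that[of l l 0]) auto
next
  case False
  then obtain l' where l': "l0 \<le> l'" "\<not> C l' \<le> B"
    by auto
  then have "l0 < l'"
    using affordable by (cases "l0 = l'") auto
  \<comment> \<open>The final error is at most \<open>(y - x) * K\<close>, to be divided by
    \<open>x \<ge> l0\<close>; this gap keeps the quotient below \<open>e\<close>. The
    \<open>+ 1\<close> covers \<open>K = 0\<close>.\<close>
  define d where "d = l0 * e / (K + 1)"
  have "0 < d"
    using affordable \<open>0 < e\<close> bounded by (simp add: d_def)
  obtain x y where xy: "l0 \<le> x" "x < y" "y < x + d" "C x \<le> B" "\<not> C y \<le> B"
    using crossing_within[of l0 l' d "\<lambda>l. C l \<le> B"] \<open>l0 < l'\<close> \<open>0 < d\<close> affordable l' by auto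
  \<comment> \<open>The weight at which the expected cost is exactly \<open>B\<close>.\<close>
  define q where "q = (B - C x) / (C y - C x)"
  have q: "0 \<le> q" "q \<le> 1"
    using xy by (auto simp: q_def field_simps)
  have "q * (C y - C x) = B - C x"
    using xy by (simp add: q_def)
  then have cost: "(1 - q) * C x + q * C y = B"
    by (simp add: algebra_simps)
  have "(1 - q) * (C x - x * U x) \<le> (1 - q) * (P - x * V)"
    using q xy affordable by (intro mult_left_mono lagrangian) auto
  moreover have "q * (C y - y * U y) \<le> q * (P - y * V)"
    using q xy affordable by (intro mult_left_mono lagrangian) auto
  \<comment> \<open>Taking \<open>x\<close> as common multiplier leaves an error from
    \<open>y - x\<close>; exhausting the budget makes \<open>P - B \<le> 0\<close>.\<close>
  ultimately have "x * (V - ((1 - q) * U x + q * U y)) \<le> P - B + q * ((y - x) * (U y - V))"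
    using cost by (simp add: algebra_simps)
  also have "\<dots> \<le> q * ((y - x) * K)"
  proof -
    have "q * ((y - x) * (U y - V)) \<le> q * ((y - x) * K)"
      using q xy bounded by (intro mult_left_mono) auto
    then show ?thesis
      using budget by simp
  qed
  also have "\<dots> \<le> 1 * ((y - x) * K)"
    using q xy bounded by (intro mult_right_mono) auto
  also have "\<dots> \<le> d * (K + 1)"
    using xy bounded \<open>0 < d\<close> by (simp add: mult_mono)
  also have "\<dots> = l0 * e"
    using bounded by (simp add: d_def)
  also have "\<dots> \<le> x * e"
    using xy \<open>0 < e\<close> by simp
  finally have "V - ((1 - q) * U x + q * U y) \<le> e"
    using xy affordable by simp
  then show thesis
    using xy q cost affordable by (intro that[of x y q]) auto
qed

lemma finite_if_all_functions_attain_max: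
  assumes "\<And>g :: 'a \<Rightarrow> real. \<exists>m\<in>S. \<forall>x\<in>S. g x \<le> g m"
  shows "finite S"
proof (rule ccontr)
  assume "infinite S"
  then obtain h :: "nat \<Rightarrow> 'a" where h: "inj h" "range h \<subseteq> S"
    using infinite_countable_subset by blast
  \<comment> \<open>\<open>inv h\<close> is the index along the injective sequence \<open>h\<close>.
    Even if \<open>m\<close> lies outside its range, \<open>inv h m\<close> is some number, and the
    next point of the sequence exceeds it.\<close>
  obtain m where m: "\<forall>x\<in>S. real (inv h x) \<le> real (inv h m)"
    using assms[of "\<lambda>x. real (inv h x)"] by blast
  have "real (inv h (h (Suc (inv h m)))) \<le> real (inv h m)"
    using m h by blast
  then show False
    using h by simp
qed

text \<open>One coin toss selects a whole action sequence; finite support yields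
  integrability.\<close>

lemma has_strong_regret_mixture:
  assumes "has_strong_regret T A u c B M a \<epsilon>"
    and "0 \<le> q" "q \<le> 1" "\<And>t. t < T \<Longrightarrow> b t \<in> A" "\<And>t. t < T \<Longrightarrow> b' t \<in> A"
    and "(1 - q) * (\<Sum>t<T. c t (b t)) + q * (\<Sum>t<T. c t (b' t)) \<le> B"
  shows "(1 - q) * (\<Sum>t<T. u t (b t)) + q * (\<Sum>t<T. u t (b' t)) \<le> (\<Sum>t<T. u t (a t)) + \<epsilon> * M"
proof -
  define p where "p = map_pmf (\<lambda>z. if z then b' else b) (bernoulli_pmf q)"
  have fin: "finite (set_pmf p)"
    by (simp add: p_def)
  have expectation: "measure_pmf.expectation p F = (1 - q) * F b + q * F b'"
    for F :: "(nat \<Rightarrow> 'a) \<Rightarrow> real"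
    using assms(2,3) by (simp add: p_def)
  have "AE a' in measure_pmf p. \<forall>t<T. a' t \<in> A"
    using assms(4,5) by (auto simp: AE_measure_pmf_iff p_def)
  moreover have "measure_pmf.expectation p (\<lambda>a'. \<Sum>t<T. c t (a' t)) \<le> B"
    using assms(6) by (simp add: expectation)
  ultimately have "measure_pmf.expectation p (\<lambda>a'. \<Sum>t<T. u t (a' t))
      \<le> (\<Sum>t<T. u t (a t)) + \<epsilon> * M"
    using assms(1) measure_pmf.prob_space_axioms[of p] integrable_measure_pmf_finite[OF fin]
    unfolding has_strong_regret_def by blast
  then show ?thesis
    by (simp add: expectation)
qed

text \<open>The sequence \<open>a\<close> is itself an admissible comparison.\<close>

lemma has_strong_regret_nonneg:
  assumes "has_strong_regret T A u c B M a \<epsilon>"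
  shows "0 \<le> \<epsilon> * M"
  using has_strong_regret_mixture[OF assms, of 0 a a] assms
  by (auto simp: has_strong_regret_def)

section \<open>A single round of the menu\<close>

lemma menu_outcome_zero: "menu_outcome E i t g 0 = point_without E i t"
proof -
  have "menu_objective E i t g 0 = objective_without E i t"
    by (rule ext) (simp add: menu_objective_def)
  then show ?thesis
    by (simp add: menu_outcome_def point_without_def)
qed

lemma menu_objective_bid:
  assumes "i \<in> {1..num_players E}"
  shows "menu_objective E i t (reported E i) (bid E i t) = objective E t"
proof
  fix x
  have "(\<Sum>j\<in>{1..num_players E}. bid E j t * reported E j x)
      = bid E i t * reported E i x
        + (\<Sum>j\<in>{1..num_players E} - {i}. bid E j t * reported E j x)"
    using assms by (intro sum.remove) auto
  then show "menu_objective E i t (reported E i) (bid E i t) x = objective E t x"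
    by (simp add: menu_objective_def objective_def objective_without_def)
qed

lemma point_Suc_eq_menu_outcome:
  assumes "apex_execution E" "i \<in> {1..num_players E}" "t < num_rounds E"
  shows "point E (Suc t) = menu_outcome E i t (reported E i) (bid E i t)"
  using assms by (simp add: apex_execution_def menu_outcome_def menu_objective_bid)

context
  fixes E :: "'x apex_run" and i t :: nat
  assumes correct: "locally_correct E i" and round: "t < num_rounds E"
begin

text \<open>Up to a constant that cancels, the objective for \<open>f\<close> and \<open>l\<close>
  is \<open>l\<close> times utility minus charge, and local correctness compares its maximizer with
  any other outcome of the round.\<close>

lemma menu_charge_lagrangian:
  assumes "0 \<le> l" "0 \<le> l'"
  shows "menu_charge E i t f l - l * f (menu_outcome E i t f l)
    \<le> menu_charge E i t g l' - l * f (menu_outcome E i t g l')"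
proof -
  have "menu_objective E i t f l (menu_outcome E i t g l')
      \<le> menu_objective E i t f l (menu_outcome E i t f l)"
    using correct round assms unfolding locally_correct_def by blast
  then show ?thesis
    by (simp add: menu_charge_def menu_objective_def)
qed

lemma menu_charge_nonneg: "0 \<le> l \<Longrightarrow> 0 \<le> menu_charge E i t g l"
  using menu_charge_lagrangian[of 0 l g g] by (simp add: menu_charge_def menu_outcome_zero)

text \<open>Comparison with the bid \<open>0\<close>, which is free.\<close>

lemma menu_charge_le: "0 \<le> l \<Longrightarrow>
    menu_charge E i t f l \<le> l * (f (menu_outcome E i t f l) - f (point_without E i t))"
  using menu_charge_lagrangian[of l 0 f f]
  by (simp add: menu_charge_def menu_outcome_zero algebra_simps)

lemma finite_menu_outcomes: "finite {menu_outcome E i t g l |g l. 0 \<le> l}"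
proof (rule finite_if_all_functions_attain_max)
  fix G :: "'x \<Rightarrow> real"
  \<comment> \<open>Reports are arbitrary functions, so this one with bid \<open>1\<close> turns the
    round's objective into exactly \<open>G\<close>.\<close>
  let ?g = "\<lambda>x. G x - objective_without E i t x"
  have obj: "menu_objective E i t ?g 1 x = G x" for x
    by (simp add: menu_objective_def)
  have "G (menu_outcome E i t g l) \<le> G (menu_outcome E i t ?g 1)" if "0 \<le> l" for g l
    using correct round that unfolding locally_correct_def
    by (metis (no_types, lifting) obj zero_le_one)
  moreover have "menu_outcome E i t ?g 1 \<in> {menu_outcome E i t g l |g l. 0 \<le> l}"
    using zero_le_one by blast
  ultimately show "\<exists>m\<in>{menu_outcome E i t g l |g l. 0 \<le> l}.
      \<forall>x\<in>{menu_outcome E i t g l |g l. 0 \<le> l}. G x \<le> G m"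
    by blast
qed

text \<open>Finitely many outcomes leave finitely many positive charges, hence a smallest one if
  any. A bid \<open>l\<close> is charged at most \<open>l\<close>, so a bid below all of them costs
  nothing.\<close>

lemma eventually_menu_charge_zero:
  assumes range: "\<And>x. f x \<in> {0..1}"
  shows "\<forall>\<^sub>F l in at_right 0. menu_charge E i t f l = 0"
proof -
  let ?C = "{c \<in> (\<lambda>x. objective_without E i t (point_without E i t) - objective_without E i t x)
    ` {menu_outcome E i t g l |g l. 0 \<le> l}. 0 < c}"
  have "finite ?C"
    using finite_menu_outcomes by simp
  then have "\<forall>\<^sub>F l in at_right 0. \<forall>c\<in>?C. l < c"
    by (rule eventually_ball_finite)
      (auto intro: order_tendstoD(2)[OF tendsto_ident_at])
  moreover have "\<forall>\<^sub>F l in at_right 0. (0::real) < l"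
    by (rule eventually_at_right_less)
  ultimately show ?thesis
  proof eventually_elim
    case (elim l)
    have "f (menu_outcome E i t f l) - f (point_without E i t) \<le> 1"
      using range[of "menu_outcome E i t f l"] range[of "point_without E i t"] by auto
    then have "l * (f (menu_outcome E i t f l) - f (point_without E i t)) \<le> l * 1"
      using elim by (intro mult_left_mono) auto
    then have "\<not> l < menu_charge E i t f l"
      using menu_charge_le[of l f] elim(2) by linarith
    moreover have "menu_charge E i t f l \<in> ?C" if "0 < menu_charge E i t f l"
      using that elim unfolding menu_charge_def by (auto intro!: imageI less_imp_le)
    ultimately show ?case
      using elim menu_charge_nonneg[of l f] by force
  qed
qed

end

theorem lemma4:
  fixes E :: "'x apex_run" and i :: nat and f :: "'x \<Rightarrow> real" and B \<epsilon> :: real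
  assumes execution: "apex_execution E"
    and player: "i \<in> {1..num_players E}"
    and truthful: "reported E i = f"
    and range: "\<And>x. f x \<in> {0..1}"
    and regret: "has_strong_regret (num_rounds E) {0..}
                   (\<lambda>t l. f (menu_outcome E i t f l)) (\<lambda>t l. menu_charge E i t f l)
                   B 1 (bid E i) \<epsilon>"
    and correct: "locally_correct E i"
  shows "truth_dominant E i B f (2 * \<epsilon>)"
  unfolding truth_dominant_def
proof (intro allI impI)
  fix g l
  assume feasible: "feasible_option E i B g l"
  let ?T = "num_rounds E"
  define C where "C a = (\<Sum>t<?T. menu_charge E i t f a)" for a
  define U where "U a = (\<Sum>t<?T. f (menu_outcome E i t f a))" for a
  define P where "P = (\<Sum>t<?T. menu_charge E i t g (l t))"
  define V where "V = (\<Sum>t<?T. f (menu_outcome E i t g (l t)))"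
  define W where "W = (\<Sum>t<?T. f (menu_outcome E i t f (bid E i t)))"
  have l: "0 \<le> l t" if "t < ?T" for t
    using feasible that by (simp add: feasible_option_def)
  have P: "P \<le> B"
    using feasible by (simp add: feasible_option_def P_def)
  have "0 \<le> P"
    unfolding P_def using l by (auto intro!: sum_nonneg menu_charge_nonneg[OF correct])
  \<comment> \<open>There are finitely many rounds, so one positive bid is free in all of them,
    hence affordable as \<open>0 \<le> P \<le> B\<close>.\<close>
  have "\<forall>\<^sub>F a in at_right 0. \<forall>t\<in>{..<?T}. menu_charge E i t f a = 0"
    using eventually_menu_charge_zero[OF correct _ range] by (intro eventually_ball_finite) auto
  then have "\<forall>\<^sub>F a in at_right 0. (\<forall>t\<in>{..<?T}. menu_charge E i t f a = 0) \<and> 0 < a"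
    using eventually_at_right_less by (rule eventually_conj)
  then obtain l0 where "\<forall>t\<in>{..<?T}. menu_charge E i t f l0 = 0" "0 < l0"
    using eventually_happens'[OF trivial_limit_at_right_real] by blast
  then have l0: "0 < l0" "C l0 \<le> B"
    using P \<open>0 \<le> P\<close> by (auto simp: C_def)
  have lagrangian: "C a - a * U a \<le> P - a * V" if "0 \<le> a" for a
  proof -
    \<comment> \<open>The same multiplier \<open>a\<close> serves every round, so the inequalities
      add up although \<open>l t\<close> varies.\<close>
    have "(\<Sum>t<?T. menu_charge E i t f a - a * f (menu_outcome E i t f a))
        \<le> (\<Sum>t<?T. menu_charge E i t g (l t) - a * f (menu_outcome E i t g (l t)))"
      using l that by (intro sum_mono menu_charge_lagrangian[OF correct]) auto
    then show ?thesis
      by (simp add: C_def U_def P_def V_def sum_subtractf sum_distrib_left)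
  qed
  have nonneg: "0 \<le> C a" if "0 \<le> a" for a
    unfolding C_def using that by (auto intro!: sum_nonneg menu_charge_nonneg[OF correct])
  have U: "U a \<le> real ?T" for a
    using sum_bounded_above[of "{..<?T}" "\<lambda>t. f (menu_outcome E i t f a)" 1] range
    by (simp add: U_def)
  have "0 \<le> V"
    unfolding V_def using range by (intro sum_nonneg) auto
  then have bounded: "U a - V \<le> real ?T" for a
    using U[of a] by simp
  have "V \<le> W + \<epsilon> + e" if e: "0 < e" for e
  proof -
    obtain x y q where mix: "0 \<le> x" "0 \<le> y" "0 \<le> q" "q \<le> 1"
      "(1 - q) * C x + q * C y \<le> B" "V \<le> (1 - q) * U x + q * U y + e"
      using budget_mixture_near_optimal[OF lagrangian nonneg bounded of_nat_0_le_iff P l0 e]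
      by blast
    have "(1 - q) * U x + q * U y \<le> W + \<epsilon>"
      using has_strong_regret_mixture[OF regret mix(3,4), of "\<lambda>_. x" "\<lambda>_. y"] mix
      by (simp add: C_def U_def W_def)
    then show ?thesis
      using mix by simp
  qed
  then have "V \<le> W + \<epsilon>"
    by (rule field_le_epsilon)
  \<comment> \<open>Relaxes the bound \<open>W + \<epsilon>\<close> to the claimed
    \<open>2 * \<epsilon>\<close>.\<close>
  moreover have "0 \<le> \<epsilon>"
    using has_strong_regret_nonneg[OF regret] by simp
  moreover have "(\<Sum>t<?T. f (point E (Suc t))) = W"
    unfolding W_def using point_Suc_eq_menu_outcome[OF execution player] truthful
    by (intro sum.cong) auto
  ultimately show "(\<Sum>t<?T. f (menu_outcome E i t g (l t)))
      \<le> (\<Sum>t<?T. f (point E (Suc t))) + 2 * \<epsilon>"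
    by (simp add: V_def)
qed

end
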